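(* Let $\gamma>0$ and let $\bar u\in L^2(\Omega)$ be a solution (optimal control) of the problem $$(P_\gamma)\qquad \min_{(y,u)\in H_0^1(\Omega)\times L^2(\Omega)}\ \frac12\|y-y_d\|^2_{L^2(\Omega)}+\frac{\alpha}{2}\|u\|^2_{L^2(\Omega)}+\beta\,\Upsilon_{p,\gamma}(u)\quad\text{subject to } Ay=u+f\ \text{in }\Omega,\ y=0\ \text{on }\Gamma.$$ Then there exist $\bar y=S(\bar u+f)\in H_0^1(\Omega)$, an adjoint state $\bar\phi\in H_0^1(\Omega)$, a multiplier $\zeta\in L^2(\Omega)$, and $\bar w$ given by $$\bar w(x)=\begin{cases}\Big[\delta_\gamma-\frac1p\Big(|\bar u(x)|+\frac1\gamma\frac{1-p}{p}\Big)^{\frac{1-p}{p}}\Big]\operatorname{sign}(\bar u(x)), & |\bar u(x)|>\frac1\gamma,\\ 0,&\text{otherwise,}\end{cases}$$ such that $$A\bar y=\bar u+f\ \text{in }\Omega,\quad \bar y=0\ \text{on }\Gamma,$$ $$A^*\bar\phi=\bar y-y_d\ \text{in }\Omega,\quad \bar\phi=0\ \text{on }\Gamma,$$ $$\bar\phi+\alpha\bar u+\beta(\delta_\gamma\zeta-\bar w)=0,$$ and, for almost all $x\in\Omega$: $\zeta(x)=1$ if $\bar u(x)>0$, $\zeta(x)=-1$ if $\bar u(x)<0$, and $|\zeta(x)|\le1$ if $\bar u(x)=0$.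
   Context: Let $\Omega\subset\mathbb{R}^n$ ($n=2$ or $n=3$) be a bounded Lipschitz domain with boundary $\Gamma$, let $p>1$, $\alpha>0$, $\beta>0$, and $f,y_d\in L^2(\Omega)$. Let $A$ be the differential operator $(Ay)(x)=-\sum_{i,j=1}^n\frac{\partial}{\partial x_i}\big(a_{ij}(x)\frac{\partial y(x)}{\partial x_j}\big)+c_0\,y(x)$ with $a_{ij}\in C^{0,1}(\bar\Omega)$, $c_0\in L^\infty(\Omega)$, $(a_{ij})$ symmetric, and such that there is $\sigma>0$ with $\sum_{i,j}a_{ij}(x)\xi_i\xi_j\ge\sigma|\xi|^2$ for all $\xi\in\mathbb{R}^n$ and almost all $x\in\Omega$. Put $a(y,v)=\int_\Omega \sum_{i,j}a_{ij}\frac{\partial y}{\partial x_j}\frac{\partial v}{\partial x_i}+c_0yv\,dx$. It is a standing assumption that for each $w\in L^2(\Omega)$ there is a unique $y\in H_0^1(\Omega)$ with $a(y,v)=(w,v)_{L^2(\Omega)}$ for all $v\in H_0^1(\Omega)$, and that the linear map $S:L^2(\Omega)\to H_0^1(\Omega)$, $w\mapsto y$, is continuous. Boundary value problems are understood in this weak sense: "$Ay=w$ in $\Omega$, $y=0$ on $\Gamma$" means $y=Sw$. $A^*$ is the adjoint of $A$: "$A^*\phi=w$ in $\Omega$, $\phi=0$ on $\Gamma$" means $\phi\in H^1_0(\Omega)$ and $a(v,\phi)=(w,v)_{L^2(\Omega)}$ for all $v\in H_0^1(\Omega)$. For $\gamma>0$ define $h_{p,\gamma}:\mathbb{R}\to\mathbb{R}$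 by $h_{p,\gamma}(v)=\frac{\gamma^{p-1}}{p}|v|^p$ if $|v|\le\frac1\gamma$ and $h_{p,\gamma}(v)=|v|+\frac1\gamma\frac{1-p}{p}$ otherwise; $\Upsilon_{p,\gamma}(u)=\int_\Omega h_{p,\gamma}(u(x))^{1/p}\,dx$; and $\delta_\gamma=\gamma^{\frac{p-1}{p}}/p^{\frac1p}$. *)

theory Defs
  imports "HOL-Analysis.Analysis"
begin

text \<open>
  Near each boundary point \<open>x\<close> there are a unit vector \<open>e\<close> and a Lipschitz function \<open>g\<close> on a disc in
  the hyperplane orthogonal to \<open>e\<close> such that, inside the open cylinder
  \<open>{x + v + t e. |v| < r, |t| < h}\<close>, the set \<open>\<Omega>\<close> is exactly the part strictly above the graph of \<open>g\<close>.
  The cylinder being open, the boundary of \<open>\<Omega>\<close> within it is then the graph itself.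
\<close>

definition lipschitz_boundary :: "(real^'n) set \<Rightarrow> bool" where
  "lipschitz_boundary \<Omega> \<longleftrightarrow>
     (\<forall>x\<in>frontier \<Omega>. \<exists>e r h g L.
        norm e = 1 \<and> r > 0 \<and> h > 0 \<and>
        L-lipschitz_on {v. v \<bullet> e = 0 \<and> norm v < r} g \<and>
        (\<forall>v. v \<bullet> e = 0 \<and> norm v < r \<longrightarrow>
           \<bar>g v\<bar> < h \<and> (\<forall>t::real. \<bar>t\<bar> < h \<longrightarrow> (x + v + t *\<^sub>R e \<in> \<Omega> \<longleftrightarrow> g v < t))))"

definition bounded_lipschitz_domain :: "(real^'n) set \<Rightarrow> bool" where
  "bounded_lipschitz_domain \<Omega> \<longleftrightarrow>
     \<Omega> \<noteq> {} \<and> open \<Omega> \<and> connected \<Omega> \<and> bounded \<Omega> \<and> lipschitz_boundary \<Omega>"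

text \<open>
  Elements of the function spaces are represented by functions on the whole space; only their
  values almost everywhere on \<open>\<Omega>\<close> matter, and equality in these spaces is equality almost
  everywhere with respect to \<^term>\<open>lebesgue_on \<Omega>\<close>.
\<close>

definition L2 :: "(real^'n) set \<Rightarrow> (real^'n \<Rightarrow> real) set" where
  "L2 \<Omega> = {u. u \<in> borel_measurable (lebesgue_on \<Omega>) \<and> integrable (lebesgue_on \<Omega>) (\<lambda>x. (u x)\<^sup>2)}"

definition Linfty :: "(real^'n) set \<Rightarrow> (real^'n \<Rightarrow> real) set" where
  "Linfty \<Omega> = {u. u \<in> borel_measurable (lebesgue_on \<Omega>) \<and> (\<exists>C. AE x in lebesgue_on \<Omega>. \<bar>u x\<bar> \<le> C)}"

definition L2_inner :: "(real^'n) set \<Rightarrow> (real^'n \<Rightarrow> real) \<Rightarrow> (real^'n \<Rightarrow> real) \<Rightarrow> real" where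
  "L2_inner \<Omega> u v = (LINT x|lebesgue_on \<Omega>. u x * v x)"

definition L2_norm :: "(real^'n) set \<Rightarrow> (real^'n \<Rightarrow> real) \<Rightarrow> real" where
  "L2_norm \<Omega> u = sqrt (L2_inner \<Omega> u u)"

definition partial_deriv :: "'n \<Rightarrow> (real^'n \<Rightarrow> real) \<Rightarrow> real^'n \<Rightarrow> real" where
  "partial_deriv i \<phi> x = frechet_derivative \<phi> (at x) (axis i 1)"

primrec C_k :: "nat \<Rightarrow> (real^'n \<Rightarrow> real) \<Rightarrow> bool" where
  "C_k 0 \<phi> \<longleftrightarrow> continuous_on UNIV \<phi>"
| "C_k (Suc k) \<phi> \<longleftrightarrow> \<phi> differentiable_on UNIV \<and> (\<forall>i. C_k k (partial_deriv i \<phi>))"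

definition test_functions :: "(real^'n) set \<Rightarrow> (real^'n \<Rightarrow> real) set" where
  "test_functions \<Omega> =
     {\<phi>. (\<forall>k. C_k k \<phi>) \<and> compact (closure {x. \<phi> x \<noteq> 0}) \<and> closure {x. \<phi> x \<noteq> 0} \<subseteq> \<Omega>}"

definition has_weak_partial ::
    "(real^'n) set \<Rightarrow> 'n \<Rightarrow> (real^'n \<Rightarrow> real) \<Rightarrow> (real^'n \<Rightarrow> real) \<Rightarrow> bool" where
  "has_weak_partial \<Omega> i y g \<longleftrightarrow>
     (\<forall>\<phi>\<in>test_functions \<Omega>. L2_inner \<Omega> y (partial_deriv i \<phi>) = - L2_inner \<Omega> g \<phi>)"

definition H1 :: "(real^'n) set \<Rightarrow> (real^'n \<Rightarrow> real) set" where
  "H1 \<Omega> = {y \<in> L2 \<Omega>. \<forall>i. \<exists>g\<in>L2 \<Omega>. has_weak_partial \<Omega> i y g}"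

text \<open>
  A representative of the weak derivative; it is meaningful for members of \<^term>\<open>H1 \<Omega>\<close>, where it is
  determined up to a null set.
\<close>

definition weak_partial :: "(real^'n) set \<Rightarrow> 'n \<Rightarrow> (real^'n \<Rightarrow> real) \<Rightarrow> real^'n \<Rightarrow> real" where
  "weak_partial \<Omega> i y = (SOME g. g \<in> L2 \<Omega> \<and> has_weak_partial \<Omega> i y g)"

definition H1_norm :: "(real^'n) set \<Rightarrow> (real^'n \<Rightarrow> real) \<Rightarrow> real" where
  "H1_norm \<Omega> y = sqrt ((L2_norm \<Omega> y)\<^sup>2 + (\<Sum>i\<in>UNIV. (L2_norm \<Omega> (weak_partial \<Omega> i y))\<^sup>2))"

definition H10 :: "(real^'n) set \<Rightarrow> (real^'n \<Rightarrow> real) set" where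
  "H10 \<Omega> = {y \<in> H1 \<Omega>. \<forall>\<epsilon>>0. \<exists>\<phi>\<in>test_functions \<Omega>. H1_norm \<Omega> (\<lambda>x. y x - \<phi> x) < \<epsilon>}"

text \<open>
  Throughout, \<open>a i j\<close> is the coefficient function \<open>a\<^sub>i\<^sub>j\<close> and \<open>c0\<close> the zeroth-order coefficient.
\<close>

definition bilinear_form ::
    "(real^'n) set \<Rightarrow> ('n \<Rightarrow> 'n \<Rightarrow> real^'n \<Rightarrow> real) \<Rightarrow> (real^'n \<Rightarrow> real) \<Rightarrow>
     (real^'n \<Rightarrow> real) \<Rightarrow> (real^'n \<Rightarrow> real) \<Rightarrow> real" where
  "bilinear_form \<Omega> a c0 y v =
     (LINT x|lebesgue_on \<Omega>.
        (\<Sum>i\<in>UNIV. \<Sum>j\<in>UNIV. a i j x * weak_partial \<Omega> j y x * weak_partial \<Omega> i v x)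
        + c0 x * y x * v x)"

text \<open>\<open>A y = w\<close> in \<open>\<Omega>\<close> and \<open>y = 0\<close> on the boundary, in the weak sense.\<close>

definition solves_state ::
    "(real^'n) set \<Rightarrow> ('n \<Rightarrow> 'n \<Rightarrow> real^'n \<Rightarrow> real) \<Rightarrow> (real^'n \<Rightarrow> real) \<Rightarrow>
     (real^'n \<Rightarrow> real) \<Rightarrow> (real^'n \<Rightarrow> real) \<Rightarrow> bool" where
  "solves_state \<Omega> a c0 w y \<longleftrightarrow>
     y \<in> H10 \<Omega> \<and> (\<forall>v\<in>H10 \<Omega>. bilinear_form \<Omega> a c0 y v = L2_inner \<Omega> w v)"

text \<open>\<open>A\<^sup>* \<phi> = w\<close> in \<open>\<Omega>\<close> and \<open>\<phi> = 0\<close> on the boundary, in the weak sense.\<close>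

definition solves_adjoint ::
    "(real^'n) set \<Rightarrow> ('n \<Rightarrow> 'n \<Rightarrow> real^'n \<Rightarrow> real) \<Rightarrow> (real^'n \<Rightarrow> real) \<Rightarrow>
     (real^'n \<Rightarrow> real) \<Rightarrow> (real^'n \<Rightarrow> real) \<Rightarrow> bool" where
  "solves_adjoint \<Omega> a c0 w \<phi> \<longleftrightarrow>
     \<phi> \<in> H10 \<Omega> \<and> (\<forall>v\<in>H10 \<Omega>. bilinear_form \<Omega> a c0 v \<phi> = L2_inner \<Omega> w v)"

text \<open>
  A representative of the weak solution \<open>S w\<close>; it is meaningful when the weak solution exists and
  is unique almost everywhere.
\<close>

definition solution_op ::
    "(real^'n) set \<Rightarrow> ('n \<Rightarrow> 'n \<Rightarrow> real^'n \<Rightarrow> real) \<Rightarrow> (real^'n \<Rightarrow> real) \<Rightarrow>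
     (real^'n \<Rightarrow> real) \<Rightarrow> real^'n \<Rightarrow> real" where
  "solution_op \<Omega> a c0 w = (SOME y. solves_state \<Omega> a c0 w y)"

definition continuous_L2_H1 ::
    "(real^'n) set \<Rightarrow> ((real^'n \<Rightarrow> real) \<Rightarrow> real^'n \<Rightarrow> real) \<Rightarrow> bool" where
  "continuous_L2_H1 \<Omega> T \<longleftrightarrow>
     (\<forall>w\<in>L2 \<Omega>. \<forall>\<epsilon>>0. \<exists>\<delta>>0. \<forall>w'\<in>L2 \<Omega>.
        L2_norm \<Omega> (\<lambda>x. w' x - w x) < \<delta> \<longrightarrow> H1_norm \<Omega> (\<lambda>x. T w' x - T w x) < \<epsilon>)"

definition h_reg :: "real \<Rightarrow> real \<Rightarrow> real \<Rightarrow> real" where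
  "h_reg p \<gamma> v =
     (if \<bar>v\<bar> \<le> 1 / \<gamma> then \<gamma> powr (p - 1) / p * \<bar>v\<bar> powr p
      else \<bar>v\<bar> + 1 / \<gamma> * ((1 - p) / p))"

definition Upsilon :: "(real^'n) set \<Rightarrow> real \<Rightarrow> real \<Rightarrow> (real^'n \<Rightarrow> real) \<Rightarrow> real" where
  "Upsilon \<Omega> p \<gamma> u = (LINT x|lebesgue_on \<Omega>. h_reg p \<gamma> (u x) powr (1 / p))"

definition delta_reg :: "real \<Rightarrow> real \<Rightarrow> real" where
  "delta_reg p \<gamma> = \<gamma> powr ((p - 1) / p) / p powr (1 / p)"

definition w_reg :: "real \<Rightarrow> real \<Rightarrow> real \<Rightarrow> real" where
  "w_reg p \<gamma> v =
     (if \<bar>v\<bar> > 1 / \<gamma>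
      then (delta_reg p \<gamma> - 1 / p * (\<bar>v\<bar> + 1 / \<gamma> * ((1 - p) / p)) powr ((1 - p) / p)) * sgn v
      else 0)"

definition objective ::
    "(real^'n) set \<Rightarrow> real \<Rightarrow> real \<Rightarrow> real \<Rightarrow> real \<Rightarrow> (real^'n \<Rightarrow> real) \<Rightarrow>
     (real^'n \<Rightarrow> real) \<Rightarrow> (real^'n \<Rightarrow> real) \<Rightarrow> real" where
  "objective \<Omega> p \<gamma> \<alpha> \<beta> yd y u =
     1/2 * (L2_norm \<Omega> (\<lambda>x. y x - yd x))\<^sup>2 + \<alpha>/2 * (L2_norm \<Omega> u)\<^sup>2 + \<beta> * Upsilon \<Omega> p \<gamma> u"

definition feasible ::
    "(real^'n) set \<Rightarrow> ('n \<Rightarrow> 'n \<Rightarrow> real^'n \<Rightarrow> real) \<Rightarrow> (real^'n \<Rightarrow> real) \<Rightarrow>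
     (real^'n \<Rightarrow> real) \<Rightarrow> (real^'n \<Rightarrow> real) \<Rightarrow> (real^'n \<Rightarrow> real) \<Rightarrow> bool" where
  "feasible \<Omega> a c0 f y u \<longleftrightarrow> u \<in> L2 \<Omega> \<and> solves_state \<Omega> a c0 (\<lambda>x. u x + f x) y"

definition optimal_control ::
    "(real^'n) set \<Rightarrow> ('n \<Rightarrow> 'n \<Rightarrow> real^'n \<Rightarrow> real) \<Rightarrow> (real^'n \<Rightarrow> real) \<Rightarrow>
     real \<Rightarrow> real \<Rightarrow> real \<Rightarrow> real \<Rightarrow> (real^'n \<Rightarrow> real) \<Rightarrow> (real^'n \<Rightarrow> real) \<Rightarrow>
     (real^'n \<Rightarrow> real) \<Rightarrow> bool" where
  "optimal_control \<Omega> a c0 p \<gamma> \<alpha> \<beta> f yd u \<longleftrightarrow>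
     (\<exists>y. feasible \<Omega> a c0 f y u \<and>
        (\<forall>y' u'. feasible \<Omega> a c0 f y' u' \<longrightarrow>
           objective \<Omega> p \<gamma> \<alpha> \<beta> yd y u \<le> objective \<Omega> p \<gamma> \<alpha> \<beta> yd y' u'))"

end

(*
  The form is symmetric, so the solution operator S is symmetric on L^2 and the adjoint equation is
  a state equation. The integrand h^(1/p) equals delta |v| - W(v) with W convex and continuously
  differentiable, W' = w_reg. Linearising the concave part -W costs nothing in the needed
  direction, and dominated convergence handles the difference quotients of |u + t v|; optimality
  then gives, for every v in L^2 and q = phi + alpha u - beta w,
    (q, v) + beta delta * integral of |.|'(u; v) >= 0.
  A single direction v can be chosen for which the left-hand side is -||v||^2; that v = 0 almost
  everywhere is exactly the claimed sign condition on zeta = -q / (beta delta).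
*)
theory Submission
  imports Defs
begin

section \<open>Pointwise analysis of the regularized integrand\<close>

text \<open>Concavity of the power function, obtained without derivatives: Young's inequality with
  weights \<open>r\<close> and \<open>1 - r\<close>, multiplied by \<open>y powr (r - 1)\<close>, is
  exactly the tangent inequality at \<open>y\<close>.\<close>

lemma powr_le_tangent:
  fixes r x y :: real
  assumes "0 < r" "r < 1" "0 < x" "0 < y"
  shows "x powr r \<le> y powr r + r * y powr (r - 1) * (x - y)"
proof -
  have "x powr r * y powr (1 - r) \<le> r * x + (1 - r) * y"
    using assms by (intro Youngs_inequality_0) auto
  then have "x powr r * y powr (1 - r) * y powr (r - 1) \<le> (r * x + (1 - r) * y) * y powr (r - 1)"
    by (intro mult_right_mono) auto
  moreover have "y powr (1 - r) * y powr (r - 1) = 1" "y * y powr (r - 1) = y powr r"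
    using assms by (auto simp flip: powr_add simp: powr_mult_base)
  ultimately show ?thesis
    by (simp add: algebra_simps)
qed

text \<open>Here \<open>m\<close> is the value of \<open>h_reg\<close> at the kink |v| = 1/\<gamma>.
  The identities for \<open>delta_reg\<close> say that the inner branch \<delta>|v| of h^(1/p) and
  the outer branch meet there with equal value and equal slope.\<close>

lemma regularization_parameters:
  fixes p \<gamma> :: real
  assumes "1 < p" "0 < \<gamma>"
  defines "m \<equiv> 1 / (\<gamma> * p)"
  shows "0 < m" "1 / \<gamma> + 1 / \<gamma> * ((1 - p) / p) = m" "(1 - p) / p = 1 / p - 1"
    "delta_reg p \<gamma> = 1 / p * m powr (1 / p - 1)" "delta_reg p \<gamma> / \<gamma> = m powr (1 / p)"
    "0 < delta_reg p \<gamma>"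
proof -
  show m: "0 < m" "1 / \<gamma> + 1 / \<gamma> * ((1 - p) / p) = m" "(1 - p) / p = 1 / p - 1"
    using assms by (auto simp: m_def field_simps)
  have "(p - 1) / p = 1 - 1 / p"
    using assms by (simp add: field_simps)
  then have \<delta>: "delta_reg p \<gamma> = \<gamma> powr (1 - 1 / p) * p powr - (1 / p)"
    by (simp add: delta_reg_def powr_minus divide_inverse)
  have mp: "m powr s = \<gamma> powr - s * p powr - s" for s
    using assms by (simp add: m_def powr_divide powr_mult powr_minus field_simps)
  have "1 / p * p powr (1 - 1 / p) = p powr - (1 / p)"
    using assms by (simp add: powr_diff powr_minus_divide)
  moreover have "- (1 / p - 1) = 1 - 1 / p"
    by simp
  ultimately show "delta_reg p \<gamma> = 1 / p * m powr (1 / p - 1)"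
    unfolding \<delta> mp by (metis mult.left_commute)
  have "\<gamma> powr (1 - 1 / p) / \<gamma> = \<gamma> powr - (1 / p)"
    using assms by (simp add: powr_diff powr_minus_divide)
  then show "delta_reg p \<gamma> / \<gamma> = m powr (1 / p)"
    unfolding \<delta> mp by (metis times_divide_eq_left)
  show "0 < delta_reg p \<gamma>"
    using assms by (simp add: delta_reg_def)
qed

lemma h_reg_powr_eq:
  fixes p \<gamma> v :: real
  assumes "1 < p" "0 < \<gamma>"
  shows "h_reg p \<gamma> v powr (1 / p) =
    (if \<bar>v\<bar> \<le> 1 / \<gamma> then delta_reg p \<gamma> * \<bar>v\<bar>
     else (\<bar>v\<bar> + 1 / \<gamma> * ((1 - p) / p)) powr (1 / p))"
  using assms by (auto simp: h_reg_def delta_reg_def powr_mult powr_divide powr_powr)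

text \<open>By the matching of values and slopes at 1/\<gamma>, the line \<delta>|v| is the tangent
  at that point to the outer branch, which is concave in |v|.\<close>

lemma h_reg_powr_le:
  fixes p \<gamma> v :: real
  assumes "1 < p" "0 < \<gamma>"
  shows "h_reg p \<gamma> v powr (1 / p) \<le> delta_reg p \<gamma> * \<bar>v\<bar>"
proof (cases "\<bar>v\<bar> \<le> 1 / \<gamma>")
  case False
  note par = regularization_parameters[OF assms]
  define c where "c = 1 / \<gamma> * ((1 - p) / p)"
  have c: "1 / \<gamma> + c = 1 / (\<gamma> * p)"
    using par by (simp add: c_def)
  have "delta_reg p \<gamma> = 1 / p * (1 / \<gamma> + c) powr (1 / p - 1)"
    and "delta_reg p \<gamma> / \<gamma> = (1 / \<gamma> + c) powr (1 / p)"
    unfolding c by (fact par)+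
  then have "(\<bar>v\<bar> + c) powr (1 / p) \<le> delta_reg p \<gamma> / \<gamma> + delta_reg p \<gamma> * (\<bar>v\<bar> + c - (1 / \<gamma> + c))"
    using powr_le_tangent[of "1 / p" "\<bar>v\<bar> + c" "1 / \<gamma> + c"] assms par(1) c False by simp
  also have "\<dots> = delta_reg p \<gamma> * \<bar>v\<bar>"
    by (simp add: algebra_simps)
  finally show ?thesis
    using False assms by (simp add: h_reg_powr_eq c_def)
qed (simp add: h_reg_powr_eq assms)

lemma w_reg_minus: "w_reg p \<gamma> (- v) = - w_reg p \<gamma> v"
  by (simp add: w_reg_def sgn_minus)

lemma h_reg_minus: "h_reg p \<gamma> (- v) = h_reg p \<gamma> v"
  by (simp add: h_reg_def)

text \<open>The slope of the outer branch equals \<delta> at 1/\<gamma> and decreases from there,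
  since its exponent is negative.\<close>

lemma reg_slope_le:
  fixes p \<gamma> v :: real
  assumes "1 < p" "0 < \<gamma>" "1 / \<gamma> < v"
  shows "1 / p * (v + 1 / \<gamma> * ((1 - p) / p)) powr ((1 - p) / p) \<le> delta_reg p \<gamma>"
proof -
  note par = regularization_parameters[OF assms(1,2)]
  have "1 / (\<gamma> * p) \<le> v + 1 / \<gamma> * ((1 - p) / p)"
    using assms(3) par(2) by linarith
  then show ?thesis
    unfolding par(3) par(4) using assms(1) par(1)
    by (intro mult_left_mono powr_mono2') auto
qed

text \<open>The subtracted slope lies between 0 and \<delta>. The bound makes \<open>w_reg\<close>
  of any control square integrable, because the domain has finite measure.\<close>

lemma abs_w_reg_le:
  fixes p \<gamma> v :: real
  assumes "1 < p" "0 < \<gamma>"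
  shows "\<bar>w_reg p \<gamma> v\<bar> \<le> delta_reg p \<gamma>"
proof (cases "1 / \<gamma> < \<bar>v\<bar>")
  case True
  then show ?thesis
    using reg_slope_le[OF assms True] assms by (auto simp: w_reg_def abs_mult sgn_if)
qed (use regularization_parameters(6)[OF assms] in \<open>simp add: w_reg_def\<close>)

text \<open>With W(v) = \<delta>|v| - h(v)^(1/p), this is the subgradient inequality W(v) \<ge> W(u)
  + \<open>w_reg p \<gamma> u\<close> * (v - u). It packages convexity of W and the formula for its
  slope, so that W never has to be differentiated. On the inner branch it reduces to W \<ge>
  0.\<close>

lemma h_reg_powr_le_tangent:
  fixes p \<gamma> u v :: real
  assumes "1 < p" "0 < \<gamma>"
  shows "h_reg p \<gamma> v powr (1 / p) \<le>
    h_reg p \<gamma> u powr (1 / p) + delta_reg p \<gamma> * (\<bar>v\<bar> - \<bar>u\<bar>) - w_reg p \<gamma> u * (v - u)"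
proof -
  define c where "c = 1 / \<gamma> * ((1 - p) / p)"
  define \<delta> where "\<delta> = delta_reg p \<gamma>"
  note par = regularization_parameters[OF assms]
  have c: "1 / \<gamma> + c = 1 / (\<gamma> * p)"
    using par by (simp add: c_def)
  have pos: "0 < s + c" if "1 / \<gamma> \<le> s" for s
    using that par(1) c by linarith
  \<comment> \<open>Stated for all \<open>u\<close> and \<open>v\<close> afresh, so that the case u
    < -1/\<gamma> follows by reflecting both arguments: \<open>h_reg\<close> is even and
    \<open>w_reg\<close> is odd.\<close>
  have up: "h_reg p \<gamma> v powr (1 / p) \<le>
      h_reg p \<gamma> u powr (1 / p) + \<delta> * (\<bar>v\<bar> - \<bar>u\<bar>) - w_reg p \<gamma> u * (v - u)"
    if u: "1 / \<gamma> < u" for u v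
  proof -
    define k where "k = 1 / p * (u + c) powr (1 / p - 1)"
    have u0: "0 < u"
      using u assms by (smt (verit) divide_pos_pos)
    have tan: "(s + c) powr (1 / p) \<le> (u + c) powr (1 / p) + k * (s - u)" if "1 / \<gamma> \<le> s" for s
      using powr_le_tangent[of "1 / p" "s + c" "u + c"] pos[OF that] pos[of u] u assms
      by (simp add: k_def)
    have w: "w_reg p \<gamma> u = \<delta> - k"
      using u u0 par(3) by (simp add: w_reg_def k_def \<delta>_def c_def)
    have hu: "h_reg p \<gamma> u powr (1 / p) = (u + c) powr (1 / p)"
      using u u0 assms by (simp add: h_reg_powr_eq c_def)
    \<comment> \<open>The claim rewritten with w = \<delta> - k: a tangent line of slope
      \<open>k\<close>, plus a correction \<delta>(|v| - v) that vanishes for v \<ge> 0 and equals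
      2\<delta>|v| for v < 0.\<close>
    have "h_reg p \<gamma> v powr (1 / p) \<le> (u + c) powr (1 / p) + k * (v - u) + \<delta> * (\<bar>v\<bar> - v)"
    proof (cases "v > 1 / \<gamma>")
      case True
      then have "0 < v"
        using assms by (smt (verit) divide_pos_pos)
      then show ?thesis
        using True tan[of v] assms by (simp add: h_reg_powr_eq c_def)
    next
      case False
      \<comment> \<open>At 1/\<gamma> the tangent taken at \<open>u\<close> lies above the line of
        slope \<delta> through the origin. Going left from there it stays above, because k \<le>
        \<delta>.\<close>
      have "\<delta> / \<gamma> \<le> (u + c) powr (1 / p) + k * (1 / \<gamma> - u)"
        using tan[of "1 / \<gamma>"] c par(5) by (simp add: \<delta>_def)
      moreover have "0 \<le> (\<delta> - k) * (1 / \<gamma> - v)"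
        using reg_slope_le[OF assms u] False par(3) by (simp add: \<delta>_def k_def c_def)
      ultimately have "\<delta> * v \<le> (u + c) powr (1 / p) + k * (v - u)"
        by (simp add: algebra_simps diff_divide_distrib)
      then show ?thesis
        using h_reg_powr_le[OF assms, of v] by (simp add: \<delta>_def algebra_simps)
    qed
    then show ?thesis
      unfolding w hu using u0 by (simp add: algebra_simps)
  qed
  consider "\<bar>u\<bar> \<le> 1 / \<gamma>" | "1 / \<gamma> < u" | "1 / \<gamma> < - u"
    by linarith
  then show ?thesis
  proof cases
    case 1
    then show ?thesis
      using h_reg_powr_le[OF assms, of v] h_reg_powr_eq[OF assms, of u]
      by (simp add: w_reg_def algebra_simps)
  next
    case 2
    then show ?thesis
      using up by (simp add: \<delta>_def)
  next
    case 3
    then show ?thesis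
      using up[OF 3, of "- v"] by (simp add: \<delta>_def w_reg_minus h_reg_minus algebra_simps)
  qed
qed

section \<open>Square integrable functions and their inner product\<close>

lemma L2_measurable: "u \<in> L2 \<Omega> \<Longrightarrow> u \<in> borel_measurable (lebesgue_on \<Omega>)"
  by (simp add: L2_def)

lemma L2_mult_integrable:
  assumes "u \<in> L2 \<Omega>" "v \<in> L2 \<Omega>"
  shows "integrable (lebesgue_on \<Omega>) (\<lambda>x. u x * v x)"
proof (rule Bochner_Integration.integrable_bound)
  show "integrable (lebesgue_on \<Omega>) (\<lambda>x. (u x)\<^sup>2 + (v x)\<^sup>2)"
    using assms by (simp add: L2_def)
  show "(\<lambda>x. u x * v x) \<in> borel_measurable (lebesgue_on \<Omega>)"
    using L2_measurable[OF assms(1)] L2_measurable[OF assms(2)] by measurable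
  have "\<bar>a * b\<bar> \<le> a\<^sup>2 + b\<^sup>2" for a b :: real
    using sum_squares_bound[of "\<bar>a\<bar>" "\<bar>b\<bar>"] abs_ge_zero[of "a * b"]
    unfolding abs_mult power2_abs by linarith
  then show "AE x in lebesgue_on \<Omega>. norm (u x * v x) \<le> norm ((u x)\<^sup>2 + (v x)\<^sup>2)"
    by simp
qed

lemma L2_scale: "u \<in> L2 \<Omega> \<Longrightarrow> (\<lambda>x. c * u x) \<in> L2 \<Omega>"
  by (auto simp: L2_def power_mult_distrib)

lemma L2_add:
  assumes "u \<in> L2 \<Omega>" "v \<in> L2 \<Omega>"
  shows "(\<lambda>x. u x + v x) \<in> L2 \<Omega>"
  using assms L2_mult_integrable[OF assms]
  by (auto simp: L2_def power2_sum mult.assoc intro!: Bochner_Integration.integrable_add)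

lemma L2_diff: "u \<in> L2 \<Omega> \<Longrightarrow> v \<in> L2 \<Omega> \<Longrightarrow> (\<lambda>x. u x - v x) \<in> L2 \<Omega>"
  using L2_add[of u \<Omega> "\<lambda>x. (-1) * v x"] L2_scale[of v \<Omega> "-1"] by simp

lemma L2_const: "\<Omega> \<in> lmeasurable \<Longrightarrow> (\<lambda>x. c) \<in> L2 \<Omega>"
  using finite_measure.integrable_const[OF finite_measure_lebesgue_on] by (auto simp: L2_def)

lemma L2_abs: "u \<in> L2 \<Omega> \<Longrightarrow> (\<lambda>x. \<bar>u x\<bar>) \<in> L2 \<Omega>"
  by (auto simp: L2_def)

lemma L2_dominated:
  assumes "g \<in> L2 \<Omega>" "u \<in> borel_measurable (lebesgue_on \<Omega>)" "\<And>x. \<bar>u x\<bar> \<le> g x"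
  shows "u \<in> L2 \<Omega>"
proof -
  have "integrable (lebesgue_on \<Omega>) (\<lambda>x. (u x)\<^sup>2)"
  proof (rule Bochner_Integration.integrable_bound)
    show "integrable (lebesgue_on \<Omega>) (\<lambda>x. (g x)\<^sup>2)"
      using assms by (simp add: L2_def)
    show "AE x in lebesgue_on \<Omega>. norm ((u x)\<^sup>2) \<le> norm ((g x)\<^sup>2)"
      using assms(3) power_mono[OF assms(3) abs_ge_zero, of _ 2] by auto
  qed (use assms in simp)
  then show ?thesis
    using assms by (simp add: L2_def)
qed

lemma L2_integrable:
  assumes "\<Omega> \<in> lmeasurable" "u \<in> L2 \<Omega>"
  shows "integrable (lebesgue_on \<Omega>) u"
  using L2_mult_integrable[OF assms(2) L2_const[OF assms(1), of 1]] by simp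

lemma L2_inner_commute: "L2_inner \<Omega> u v = L2_inner \<Omega> v u"
  by (simp add: L2_inner_def mult.commute)

lemma L2_inner_add_right:
  assumes "u \<in> L2 \<Omega>" "v \<in> L2 \<Omega>" "w \<in> L2 \<Omega>"
  shows "L2_inner \<Omega> u (\<lambda>x. v x + t * w x) = L2_inner \<Omega> u v + t * L2_inner \<Omega> u w"
proof -
  have "L2_inner \<Omega> u (\<lambda>x. v x + t * w x) = (LINT x|lebesgue_on \<Omega>. u x * v x + t * (u x * w x))"
    unfolding L2_inner_def by (simp add: algebra_simps)
  then show ?thesis
    using assms by (simp add: L2_inner_def L2_mult_integrable)
qed

lemma L2_norm_power2: "(L2_norm \<Omega> u)\<^sup>2 = L2_inner \<Omega> u u"
  by (simp add: L2_norm_def L2_inner_def)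

lemma L2_inner_cong_AE:
  assumes "u \<in> L2 \<Omega>" "u' \<in> L2 \<Omega>" "v \<in> L2 \<Omega>" "v' \<in> L2 \<Omega>"
    and "AE x in lebesgue_on \<Omega>. u x = u' x" "AE x in lebesgue_on \<Omega>. v x = v' x"
  shows "L2_inner \<Omega> u v = L2_inner \<Omega> u' v'"
  unfolding L2_inner_def
proof (rule integral_cong_AE)
  show "AE x in lebesgue_on \<Omega>. u x * v x = u' x * v' x"
    using assms(5,6) by eventually_elim simp
qed (use assms in \<open>auto simp: L2_def\<close>)

lemma L2_norm_power2_add:
  assumes "u \<in> L2 \<Omega>" "v \<in> L2 \<Omega>"
  shows "(L2_norm \<Omega> (\<lambda>x. u x + t * v x))\<^sup>2 =
    (L2_norm \<Omega> u)\<^sup>2 + 2 * t * L2_inner \<Omega> u v + t\<^sup>2 * (L2_norm \<Omega> v)\<^sup>2"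
proof -
  note [simp] = L2_inner_add_right L2_add L2_scale assms
  have "L2_inner \<Omega> (\<lambda>x. u x + t * v x) u = L2_inner \<Omega> u u + t * L2_inner \<Omega> u v"
    "L2_inner \<Omega> (\<lambda>x. u x + t * v x) v = L2_inner \<Omega> u v + t * L2_inner \<Omega> v v"
    by (simp_all add: L2_inner_commute[of \<Omega> "\<lambda>x. u x + t * v x"] L2_inner_commute[of \<Omega> v u])
  then show ?thesis
    unfolding L2_norm_power2 by (simp add: algebra_simps power2_eq_square)
qed

lemma L2_inner_self_eq_0_AE:
  assumes "u \<in> L2 \<Omega>" "L2_inner \<Omega> u u \<le> 0"
  shows "AE x in lebesgue_on \<Omega>. u x = 0"
proof -
  have "L2_inner \<Omega> u u = 0"
    using assms(2) by (intro antisym) (auto simp: L2_inner_def)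
  then show ?thesis
    using integral_nonneg_eq_0_iff_AE[OF L2_mult_integrable[OF assms(1,1)]]
    by (simp add: L2_inner_def)
qed

section \<open>Symmetry and linearity of the solution operator\<close>

lemma H10_subset_L2: "H10 \<Omega> \<subseteq> L2 \<Omega>"
  by (auto simp: H10_def H1_def)

lemma solves_state_L2: "solves_state \<Omega> a c0 w y \<Longrightarrow> y \<in> L2 \<Omega>"
  using H10_subset_L2 by (auto simp: solves_state_def)

lemma bilinear_form_commute:
  assumes "\<And>i j x. x \<in> \<Omega> \<Longrightarrow> a i j x = a j i x"
  shows "bilinear_form \<Omega> a c0 y v = bilinear_form \<Omega> a c0 v y"
  unfolding bilinear_form_def
proof (rule Bochner_Integration.integral_cong[OF refl])
  fix x assume "x \<in> space (lebesgue_on \<Omega>)"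
  then have "x \<in> \<Omega>" by simp
  have "(\<Sum>i\<in>UNIV. \<Sum>j\<in>UNIV. a i j x * weak_partial \<Omega> j y x * weak_partial \<Omega> i v x) =
      (\<Sum>j\<in>UNIV. \<Sum>i\<in>UNIV. a j i x * weak_partial \<Omega> i v x * weak_partial \<Omega> j y x)"
    by (subst sum.swap) (simp add: assms[OF \<open>x \<in> \<Omega>\<close>] mult_ac cong: sum.cong)
  then show "(\<Sum>i\<in>UNIV. \<Sum>j\<in>UNIV. a i j x * weak_partial \<Omega> j y x * weak_partial \<Omega> i v x) +
      c0 x * y x * v x =
      (\<Sum>i\<in>UNIV. \<Sum>j\<in>UNIV. a i j x * weak_partial \<Omega> j v x * weak_partial \<Omega> i y x) +
      c0 x * v x * y x"
    by simp
qed

lemma solves_adjoint_iff_solves_state: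
  assumes "\<And>i j x. x \<in> \<Omega> \<Longrightarrow> a i j x = a j i x"
  shows "solves_adjoint \<Omega> a c0 w \<phi> \<longleftrightarrow> solves_state \<Omega> a c0 w \<phi>"
  using bilinear_form_commute[of \<Omega> a c0, OF assms]
  by (simp add: solves_adjoint_def solves_state_def)

text \<open>Each solution is an admissible test function in the equation of the other, so both inner
  products equal the form at the pair \<open>y\<close>, \<open>y'\<close>.\<close>

lemma solution_inner_commute:
  assumes sym: "\<And>i j x. x \<in> \<Omega> \<Longrightarrow> a i j x = a j i x"
    and "solves_state \<Omega> a c0 w y" "solves_state \<Omega> a c0 w' y'"
  shows "L2_inner \<Omega> w y' = L2_inner \<Omega> w' y"
  using assms(2,3) bilinear_form_commute[of \<Omega> a c0 y y', OF sym]
  by (simp add: solves_state_def)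

text \<open>
  The weak gradient is a choice of representatives, so linearity in \<open>w\<close> cannot be read off the weak
  formulation. Instead the defect is tested against a solution with the defect itself as
  right-hand side, which needs only the symmetry of the solution operator on \<open>L\<^sup>2\<close>.
\<close>

lemma solution_affine:
  assumes sym: "\<And>i j x. x \<in> \<Omega> \<Longrightarrow> a i j x = a j i x"
    and ex: "\<And>g. g \<in> L2 \<Omega> \<Longrightarrow> \<exists>\<psi>. solves_state \<Omega> a c0 g \<psi>"
    and L2: "w \<in> L2 \<Omega>" "v \<in> L2 \<Omega>"
    and y: "solves_state \<Omega> a c0 w y" and z: "solves_state \<Omega> a c0 v z"
    and y': "solves_state \<Omega> a c0 (\<lambda>x. w x + t * v x) y'"
  shows "AE x in lebesgue_on \<Omega>. y' x = y x + t * z x"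
proof -
  note yz = solves_state_L2[OF y] solves_state_L2[OF z] solves_state_L2[OF y']
  define d where "d = (\<lambda>x. y' x + (-1) * (y x + t * z x))"
  have yz': "(\<lambda>x. y x + t * z x) \<in> L2 \<Omega>"
    using yz by (intro L2_add L2_scale)
  then have d: "d \<in> L2 \<Omega>"
    using yz unfolding d_def by (intro L2_add L2_scale)
  obtain \<psi> where \<psi>: "solves_state \<Omega> a c0 d \<psi>"
    using ex d by blast
  note comm = solution_inner_commute[of \<Omega> a c0, OF sym _ \<psi>]
  have "L2_inner \<Omega> d y' = L2_inner \<Omega> (\<lambda>x. w x + t * v x) \<psi>"
    using comm[OF _ y'] by simp
  also have "\<dots> = L2_inner \<Omega> w \<psi> + t * L2_inner \<Omega> v \<psi>"
    unfolding L2_inner_commute[of _ _ \<psi>]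
    by (rule L2_inner_add_right[OF solves_state_L2[OF \<psi>] L2])
  also have "\<dots> = L2_inner \<Omega> d y + t * L2_inner \<Omega> d z"
    using comm[OF _ y] comm[OF _ z] by simp
  also have "\<dots> = L2_inner \<Omega> d (\<lambda>x. y x + t * z x)"
    using d yz by (simp add: L2_inner_add_right)
  finally have "L2_inner \<Omega> d d = 0"
    using L2_inner_add_right[OF d yz(3) yz', of "-1"] unfolding d_def by simp
  then have "AE x in lebesgue_on \<Omega>. d x = 0"
    using L2_inner_self_eq_0_AE[OF d] by simp
  then show ?thesis
    by eventually_elim (simp add: d_def)
qed

section \<open>The sparsity functional along a line of controls\<close>

lemma borel_measurable_h_reg [measurable]: "h_reg p \<gamma> \<in> borel_measurable borel"
  unfolding h_reg_def by measurable

lemma borel_measurable_w_reg [measurable]: "w_reg p \<gamma> \<in> borel_measurable borel"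
  unfolding w_reg_def by measurable

lemma w_reg_L2:
  assumes "1 < p" "0 < \<gamma>" "\<Omega> \<in> lmeasurable" "u \<in> L2 \<Omega>"
  shows "(\<lambda>x. w_reg p \<gamma> (u x)) \<in> L2 \<Omega>"
proof (rule L2_dominated[OF L2_const[OF assms(3)]])
  show "(\<lambda>x. w_reg p \<gamma> (u x)) \<in> borel_measurable (lebesgue_on \<Omega>)"
    using L2_measurable[OF assms(4)] by measurable
qed (rule abs_w_reg_le[OF assms(1,2)])

lemma h_reg_powr_integrable:
  assumes "1 < p" "0 < \<gamma>" "\<Omega> \<in> lmeasurable" "u \<in> L2 \<Omega>"
  shows "integrable (lebesgue_on \<Omega>) (\<lambda>x. h_reg p \<gamma> (u x) powr (1 / p))"
proof (rule L2_integrable[OF assms(3) L2_dominated[OF L2_scale[OF L2_abs[OF assms(4)]]]])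
  show "(\<lambda>x. h_reg p \<gamma> (u x) powr (1 / p)) \<in> borel_measurable (lebesgue_on \<Omega>)"
    using L2_measurable[OF assms(4)] by measurable
qed (use h_reg_powr_le[OF assms(1,2)] in simp)

text \<open>Only the W part of the integrand is replaced by its linearization. The increment of the
  modulus is kept exact, since it is not linear to first order where u = 0.\<close>

lemma Upsilon_le:
  assumes "1 < p" "0 < \<gamma>" "\<Omega> \<in> lmeasurable" "u \<in> L2 \<Omega>" "v \<in> L2 \<Omega>"
  shows "Upsilon \<Omega> p \<gamma> (\<lambda>x. u x + t * v x) \<le> Upsilon \<Omega> p \<gamma> u
    + delta_reg p \<gamma> * (LINT x|lebesgue_on \<Omega>. \<bar>u x + t * v x\<bar> - \<bar>u x\<bar>)
    - t * L2_inner \<Omega> (\<lambda>x. w_reg p \<gamma> (u x)) v"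
proof -
  have ut: "(\<lambda>x. u x + t * v x) \<in> L2 \<Omega>"
    using assms by (intro L2_add L2_scale)
  have int: "integrable (lebesgue_on \<Omega>) (\<lambda>x. h_reg p \<gamma> (u x + t * v x) powr (1 / p))"
    "integrable (lebesgue_on \<Omega>) (\<lambda>x. h_reg p \<gamma> (u x) powr (1 / p))"
    "integrable (lebesgue_on \<Omega>) (\<lambda>x. \<bar>u x + t * v x\<bar> - \<bar>u x\<bar>)"
    "integrable (lebesgue_on \<Omega>) (\<lambda>x. w_reg p \<gamma> (u x) * v x)"
    using h_reg_powr_integrable[OF assms(1-3)] ut assms(4)
      L2_integrable[OF assms(3) L2_diff[OF L2_abs[OF ut] L2_abs[OF assms(4)]]]
      L2_mult_integrable[OF w_reg_L2[OF assms(1-4)] assms(5)]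
    by auto
  have "Upsilon \<Omega> p \<gamma> (\<lambda>x. u x + t * v x) \<le> (LINT x|lebesgue_on \<Omega>. h_reg p \<gamma> (u x) powr (1 / p)
      + delta_reg p \<gamma> * (\<bar>u x + t * v x\<bar> - \<bar>u x\<bar>) - t * (w_reg p \<gamma> (u x) * v x))"
    unfolding Upsilon_def
  proof (rule integral_mono)
    fix x
    show "h_reg p \<gamma> (u x + t * v x) powr (1 / p) \<le> h_reg p \<gamma> (u x) powr (1 / p)
      + delta_reg p \<gamma> * (\<bar>u x + t * v x\<bar> - \<bar>u x\<bar>) - t * (w_reg p \<gamma> (u x) * v x)"
      using h_reg_powr_le_tangent[OF assms(1,2), of "u x + t * v x" "u x"] by (simp add: mult_ac)
  qed (use int in auto)
  also have "\<dots> = Upsilon \<Omega> p \<gamma> u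
    + delta_reg p \<gamma> * (LINT x|lebesgue_on \<Omega>. \<bar>u x + t * v x\<bar> - \<bar>u x\<bar>)
    - t * L2_inner \<Omega> (\<lambda>x. w_reg p \<gamma> (u x)) v"
    using int unfolding Upsilon_def L2_inner_def
    by simp
  finally show ?thesis .
qed

section \<open>One-sided differentiation of the modulus\<close>

text \<open>The one-sided directional derivative of |.| at \<open>u\<close> along \<open>v\<close>.
  It is positively homogeneous in \<open>v\<close> but not linear when u = 0, which is why the
  multiplier is only bounded there instead of being determined.\<close>

definition abs_dir_deriv :: "real \<Rightarrow> real \<Rightarrow> real" where
  "abs_dir_deriv u v = (if u = 0 then \<bar>v\<bar> else sgn u * v)"

text \<open>The quotient is eventually constant. If u = 0 it is |v| at every step; otherwise, once
  the step is so small that |s v| < |u|, the sign of u + s v is that of u.\<close>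

lemma abs_difference_quotient_LIMSEQ:
  "(\<lambda>n. (\<bar>u + 1 / real (Suc n) * v\<bar> - \<bar>u\<bar>) / (1 / real (Suc n))) \<longlonglongrightarrow> abs_dir_deriv u v"
proof (rule tendsto_eventually)
  obtain N :: nat where N: "u \<noteq> 0 \<Longrightarrow> \<bar>v\<bar> / \<bar>u\<bar> < real N"
    using reals_Archimedean2 by blast
  show "\<forall>\<^sub>F n in sequentially.
      (\<bar>u + 1 / real (Suc n) * v\<bar> - \<bar>u\<bar>) / (1 / real (Suc n)) = abs_dir_deriv u v"
    using eventually_ge_at_top[of N]
  proof eventually_elim
    case (elim n)
    define s where "s = 1 / real (Suc n)"
    have s: "0 < s" by (simp add: s_def)
    have small: "\<bar>s * v\<bar> < \<bar>u\<bar>" if "u \<noteq> 0"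
    proof -
      have "\<bar>v\<bar> / \<bar>u\<bar> < real (Suc n)"
        using N[OF that] elim by simp
      then show ?thesis
        using that by (simp add: s_def abs_mult field_simps)
    qed
    consider "u = 0" | "0 < u" | "u < 0" by linarith
    then have "(\<bar>u + s * v\<bar> - \<bar>u\<bar>) / s = abs_dir_deriv u v"
    proof cases
      case 1
      then show ?thesis
        using s by (simp add: abs_dir_deriv_def abs_mult)
    next
      case 2
      then have "\<bar>u + s * v\<bar> = u + s * v"
        using small by linarith
      then show ?thesis
        using 2 s by (simp add: abs_dir_deriv_def)
    next
      case 3
      then have "\<bar>u + s * v\<bar> = - (u + s * v)"
        using small by linarith
      then show ?thesis
        using 3 s by (simp add: abs_dir_deriv_def)
    qed
    then show ?case
      by (simp add: s_def)
  qed
qed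

text \<open>The modulus is 1-Lipschitz, so every quotient is dominated by |v|, which is integrable
  because the domain has finite measure.\<close>

lemma abs_difference_integral_LIMSEQ:
  assumes "\<Omega> \<in> lmeasurable" "u \<in> L2 \<Omega>" "v \<in> L2 \<Omega>"
  shows "(\<lambda>n. (LINT x|lebesgue_on \<Omega>. \<bar>u x + 1 / real (Suc n) * v x\<bar> - \<bar>u x\<bar>) / (1 / real (Suc n)))
    \<longlonglongrightarrow> (LINT x|lebesgue_on \<Omega>. abs_dir_deriv (u x) (v x))"
proof -
  note [measurable] = L2_measurable[OF assms(2)] L2_measurable[OF assms(3)]
  have "(\<lambda>n. LINT x|lebesgue_on \<Omega>. (\<bar>u x + 1 / real (Suc n) * v x\<bar> - \<bar>u x\<bar>) / (1 / real (Suc n)))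
    \<longlonglongrightarrow> (LINT x|lebesgue_on \<Omega>. abs_dir_deriv (u x) (v x))"
  proof (rule integral_dominated_convergence)
    show "(\<lambda>x. abs_dir_deriv (u x) (v x)) \<in> borel_measurable (lebesgue_on \<Omega>)"
      unfolding abs_dir_deriv_def by measurable
    show "integrable (lebesgue_on \<Omega>) (\<lambda>x. \<bar>v x\<bar>)"
      by (rule L2_integrable[OF assms(1) L2_abs[OF assms(3)]])
    show "AE x in lebesgue_on \<Omega>.
        norm ((\<bar>u x + 1 / real (Suc n) * v x\<bar> - \<bar>u x\<bar>) / (1 / real (Suc n))) \<le> \<bar>v x\<bar>" for n
    proof (rule AE_I2)
      fix x
      define s where "s = 1 / real (Suc n)"
      have "0 < s" by (simp add: s_def)
      moreover have "\<bar>\<bar>u x + s * v x\<bar> - \<bar>u x\<bar>\<bar> \<le> \<bar>s * v x\<bar>"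
        by linarith
      ultimately have "\<bar>(\<bar>u x + s * v x\<bar> - \<bar>u x\<bar>) / s\<bar> \<le> \<bar>v x\<bar>"
        by (simp add: abs_mult pos_divide_le_eq mult.commute)
      then show "norm ((\<bar>u x + 1 / real (Suc n) * v x\<bar> - \<bar>u x\<bar>) / (1 / real (Suc n))) \<le> \<bar>v x\<bar>"
        by (simp add: s_def)
    qed
  qed (use abs_difference_quotient_LIMSEQ in auto)
  then show ?thesis
    by simp
qed

section \<open>First-order condition and its pointwise form\<close>

lemma optimal_control_variational_inequality:
  fixes \<Omega> :: "(real^'n) set"
  assumes meas: "\<Omega> \<in> lmeasurable" and p: "1 < p" and gamma: "0 < \<gamma>" and beta: "0 < \<beta>"
    and sym: "\<And>i j x. x \<in> \<Omega> \<Longrightarrow> a i j x = a j i x"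
    and ex: "\<And>g. g \<in> L2 \<Omega> \<Longrightarrow> \<exists>\<psi>. solves_state \<Omega> a c0 g \<psi>"
    and f: "f \<in> L2 \<Omega>" and yd: "yd \<in> L2 \<Omega>" and u: "u \<in> L2 \<Omega>" and v: "v \<in> L2 \<Omega>"
    and y: "solves_state \<Omega> a c0 (\<lambda>x. u x + f x) y"
    and \<phi>: "solves_state \<Omega> a c0 (\<lambda>x. y x - yd x) \<phi>"
    and opt: "\<And>y' u'. feasible \<Omega> a c0 f y' u' \<Longrightarrow>
      objective \<Omega> p \<gamma> \<alpha> \<beta> yd y u \<le> objective \<Omega> p \<gamma> \<alpha> \<beta> yd y' u'"
  shows "0 \<le> L2_inner \<Omega> (\<lambda>x. \<phi> x + \<alpha> * u x - \<beta> * w_reg p \<gamma> (u x)) v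
    + \<beta> * delta_reg p \<gamma> * (LINT x|lebesgue_on \<Omega>. abs_dir_deriv (u x) (v x))"
proof -
  define D where "D t = (LINT x|lebesgue_on \<Omega>. \<bar>u x + t * v x\<bar> - \<bar>u x\<bar>)" for t
  define W where "W = (\<lambda>x. w_reg p \<gamma> (u x))"
  obtain z where z: "solves_state \<Omega> a c0 v z"
    using ex v by blast
  note L2s = solves_state_L2[OF y] solves_state_L2[OF z] solves_state_L2[OF \<phi>]
  have W: "W \<in> L2 \<Omega>"
    unfolding W_def by (rule w_reg_L2[OF p gamma meas u])
  define I where "I = L2_inner \<Omega> (\<lambda>x. \<phi> x + \<alpha> * u x - \<beta> * w_reg p \<gamma> (u x)) v"
  \<comment> \<open>The tracking and control terms are exactly quadratic in \<open>t\<close>.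
    \<open>K\<close> is their joint coefficient of t^2, so after division by \<open>t\<close> the
    remainder is t * K.\<close>
  define K where "K = ((L2_norm \<Omega> z)\<^sup>2 + \<alpha> * (L2_norm \<Omega> v)\<^sup>2) / 2"
  have I: "I = L2_inner \<Omega> v \<phi> + \<alpha> * L2_inner \<Omega> u v - \<beta> * L2_inner \<Omega> W v"
  proof -
    have "I = L2_inner \<Omega> v (\<lambda>x. (\<phi> x + \<alpha> * u x) + (- \<beta>) * W x)"
      by (simp add: I_def W_def L2_inner_commute[of _ v])
    also have "\<dots> = L2_inner \<Omega> v (\<lambda>x. \<phi> x + \<alpha> * u x) + (- \<beta>) * L2_inner \<Omega> v W"
      using L2s u v W by (intro L2_inner_add_right L2_add L2_scale)
    also have "L2_inner \<Omega> v (\<lambda>x. \<phi> x + \<alpha> * u x) = L2_inner \<Omega> v \<phi> + \<alpha> * L2_inner \<Omega> v u"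
      using L2s u v by (intro L2_inner_add_right)
    finally show ?thesis
      by (simp add: L2_inner_commute[of _ v])
  qed
  \<comment> \<open>Comparison of \<open>u\<close> with the admissible control u + t v, divided by
    \<open>t\<close>.\<close>
  have step: "0 \<le> I + \<beta> * delta_reg p \<gamma> * (D t / t) + t * K" if t: "0 < t" for t
  proof -
    have ut: "(\<lambda>x. u x + t * v x) \<in> L2 \<Omega>"
      using u v by (intro L2_add L2_scale)
    then obtain y' where y': "solves_state \<Omega> a c0 (\<lambda>x. (u x + t * v x) + f x) y'"
      using ex[OF L2_add[OF _ f]] by blast
    have le: "objective \<Omega> p \<gamma> \<alpha> \<beta> yd y u \<le> objective \<Omega> p \<gamma> \<alpha> \<beta> yd y' (\<lambda>x. u x + t * v x)"
      using ut y' by (intro opt) (simp add: feasible_def)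
    have "AE x in lebesgue_on \<Omega>. y' x = y x + t * z x"
      using y' by (intro solution_affine[OF sym ex L2_add[OF u f] v y z]) (simp_all add: add_ac)
    then have AE: "AE x in lebesgue_on \<Omega>. y' x - yd x = (y x - yd x) + t * z x"
      by eventually_elim simp
    have tracking: "(L2_norm \<Omega> (\<lambda>x. y' x - yd x))\<^sup>2 = (L2_norm \<Omega> (\<lambda>x. y x - yd x))\<^sup>2
        + 2 * t * L2_inner \<Omega> v \<phi> + t\<^sup>2 * (L2_norm \<Omega> z)\<^sup>2"
    proof -
      have "(L2_norm \<Omega> (\<lambda>x. y' x - yd x))\<^sup>2 = (L2_norm \<Omega> (\<lambda>x. (y x - yd x) + t * z x))\<^sup>2"
        unfolding L2_norm_power2
        using L2s solves_state_L2[OF y'] yd AE by (intro L2_inner_cong_AE L2_diff L2_add L2_scale)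
      also have "\<dots> = (L2_norm \<Omega> (\<lambda>x. y x - yd x))\<^sup>2
          + 2 * t * L2_inner \<Omega> (\<lambda>x. y x - yd x) z + t\<^sup>2 * (L2_norm \<Omega> z)\<^sup>2"
        using L2s yd by (intro L2_norm_power2_add L2_diff)
      \<comment> \<open>This is where the adjoint state enters: testing its equation with
        \<open>z\<close> and that of \<open>z\<close> with \<phi> removes the linearized state from
        the first-order term.\<close>
      also have "L2_inner \<Omega> (\<lambda>x. y x - yd x) z = L2_inner \<Omega> v \<phi>"
        by (rule solution_inner_commute[OF sym \<phi> z])
      finally show ?thesis .
    qed
    have "0 \<le> \<beta> * (Upsilon \<Omega> p \<gamma> u + delta_reg p \<gamma> * D t - t * L2_inner \<Omega> W v
        - Upsilon \<Omega> p \<gamma> (\<lambda>x. u x + t * v x))"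
      using Upsilon_le[OF p gamma meas u v, of t] beta by (simp add: D_def W_def)
    with le have "0 \<le> t * I + \<beta> * delta_reg p \<gamma> * D t + t\<^sup>2 * K"
      unfolding objective_def tracking L2_norm_power2_add[OF u v] I K_def
      by (simp add: algebra_simps add_divide_distrib)
    also have "\<dots> = t * (I + \<beta> * delta_reg p \<gamma> * (D t / t) + t * K)"
      using t by (simp add: field_simps power2_eq_square)
    finally show ?thesis
      using t by (simp add: zero_le_mult_iff)
  qed
  \<comment> \<open>One sequence of step sizes suffices. The shift to \<open>Suc n\<close> keeps
    every step size positive, as \<open>step\<close> demands.\<close>
  have "(\<lambda>n. I + \<beta> * delta_reg p \<gamma> * (D (1 / real (Suc n)) / (1 / real (Suc n))) + 1 / real (Suc n) * K)
    \<longlonglongrightarrow> I + \<beta> * delta_reg p \<gamma> * (LINT x|lebesgue_on \<Omega>. abs_dir_deriv (u x) (v x)) + 0 * K"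
    unfolding D_def
    by (intro tendsto_intros abs_difference_integral_LIMSEQ[OF meas u v] LIMSEQ_Suc[OF lim_1_over_n])
  then have "0 \<le> I + \<beta> * delta_reg p \<gamma> * (LINT x|lebesgue_on \<Omega>. abs_dir_deriv (u x) (v x)) + 0 * K"
    by (rule LIMSEQ_le_const) (intro exI allI impI step, simp)
  then show ?thesis
    by (simp add: I_def)
qed

text \<open>An integral inequality becomes pointwise through one direction built pointwise from
  \<open>q\<close> and \<open>u\<close>, in place of localization to measurable subsets. It is
  applied with c = \<beta>\<delta>.\<close>

lemma variational_inequality_imp_AE:
  assumes meas: "\<Omega> \<in> lmeasurable" and q: "q \<in> L2 \<Omega>" and u: "u \<in> L2 \<Omega>" and c: "0 \<le> c"
    and ineq: "\<And>v. v \<in> L2 \<Omega> \<Longrightarrow>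
      0 \<le> L2_inner \<Omega> q v + c * (LINT x|lebesgue_on \<Omega>. abs_dir_deriv (u x) (v x))"
  shows "AE x in lebesgue_on \<Omega>. if u x = 0 then \<bar>q x\<bar> \<le> c else q x = - c * sgn (u x)"
proof -
  note [measurable] = L2_measurable[OF q] L2_measurable[OF u]
  \<comment> \<open>At each point \<open>v\<close> minimizes s \<mapsto> q s + c *
    \<open>abs_dir_deriv u s\<close> + s^2/2. For u = 0 this is soft thresholding of -q at level c;
    otherwise it is the negative of the residual q + c sgn(u).\<close>
  define v where "v x = (if u x = 0 then - sgn (q x) * max 0 (\<bar>q x\<bar> - c)
    else - (q x + c * sgn (u x)))" for x
  have v: "v \<in> L2 \<Omega>"
  proof (rule L2_dominated)
    show "(\<lambda>x. \<bar>q x\<bar> + c) \<in> L2 \<Omega>"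
      using meas q by (intro L2_add L2_abs L2_const)
    show "v \<in> borel_measurable (lebesgue_on \<Omega>)"
      unfolding v_def by measurable
    show "\<bar>v x\<bar> \<le> \<bar>q x\<bar> + c" for x
      using c by (auto simp: v_def abs_mult sgn_if max_def)
  qed
  have dir: "(\<lambda>x. abs_dir_deriv (u x) (v x)) \<in> L2 \<Omega>"
  proof (rule L2_dominated[OF L2_abs[OF v]])
    note [measurable] = L2_measurable[OF v]
    show "(\<lambda>x. abs_dir_deriv (u x) (v x)) \<in> borel_measurable (lebesgue_on \<Omega>)"
      unfolding abs_dir_deriv_def by measurable
  qed (auto simp: abs_dir_deriv_def abs_mult sgn_if)
  \<comment> \<open>The first two terms of the minimized function are positively homogeneous in s,
    so optimality along the ray through \<open>v\<close> forces their sum to be -v^2.\<close>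
  have qv: "q x * v x + c * abs_dir_deriv (u x) (v x) = - (v x * v x)" for x
    using c by (auto simp: v_def abs_dir_deriv_def sgn_if max_def algebra_simps)
  have "L2_inner \<Omega> q v + c * (LINT x|lebesgue_on \<Omega>. abs_dir_deriv (u x) (v x)) =
      (LINT x|lebesgue_on \<Omega>. q x * v x + c * abs_dir_deriv (u x) (v x))"
    using L2_mult_integrable[OF q v] L2_integrable[OF meas dir] by (simp add: L2_inner_def)
  also have "\<dots> = - L2_inner \<Omega> v v"
    unfolding qv by (simp add: L2_inner_def)
  finally have "L2_inner \<Omega> q v + c * (LINT x|lebesgue_on \<Omega>. abs_dir_deriv (u x) (v x)) =
      - L2_inner \<Omega> v v" .
  then have "L2_inner \<Omega> v v \<le> 0"
    using ineq[OF v] by simp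
  then have "AE x in lebesgue_on \<Omega>. v x = 0"
    by (rule L2_inner_self_eq_0_AE[OF v])
  \<comment> \<open>Where v = 0 and u = 0, either q = 0 or the threshold was not exceeded; both give
    |q| \<le> c.\<close>
  then show ?thesis
    by eventually_elim (use c in \<open>auto simp: v_def max_def sgn_if split: if_splits\<close>)
qed


section \<open>The optimality system\<close>

theorem theorem3:
  fixes \<Omega> :: "(real^'n) set"
    and a :: "'n \<Rightarrow> 'n \<Rightarrow> real^'n \<Rightarrow> real"
    and c0 f yd ubar :: "real^'n \<Rightarrow> real"
    and p \<alpha> \<beta> \<gamma> :: real
  assumes dim: "CARD('n) = 2 \<or> CARD('n) = 3"
    and dom: "bounded_lipschitz_domain \<Omega>"
    and p: "p > 1" and alpha: "\<alpha> > 0" and beta: "\<beta> > 0"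
    and f: "f \<in> L2 \<Omega>" and yd: "yd \<in> L2 \<Omega>"
    and a_lipschitz: "\<And>i j. \<exists>L. L-lipschitz_on (closure \<Omega>) (a i j)"
    and c0: "c0 \<in> Linfty \<Omega>"
    and a_sym: "\<And>i j x. x \<in> \<Omega> \<Longrightarrow> a i j x = a j i x"
    and a_elliptic: "\<exists>\<sigma>>0. \<forall>\<xi>::real^'n. AE x in lebesgue_on \<Omega>.
          (\<Sum>i\<in>UNIV. \<Sum>j\<in>UNIV. a i j x * \<xi> $ i * \<xi> $ j) \<ge> \<sigma> * (norm \<xi>)\<^sup>2"
    and well_posed: "\<And>w. w \<in> L2 \<Omega> \<Longrightarrow>
          \<exists>y. solves_state \<Omega> a c0 w y \<and>
            (\<forall>y'. solves_state \<Omega> a c0 w y' \<longrightarrow> (AE x in lebesgue_on \<Omega>. y' x = y x))"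
    and S_continuous: "continuous_L2_H1 \<Omega> (solution_op \<Omega> a c0)"
    and gamma: "\<gamma> > 0"
    and optimal: "optimal_control \<Omega> a c0 p \<gamma> \<alpha> \<beta> f yd ubar"
  shows "\<exists>ybar\<in>H10 \<Omega>. \<exists>\<phi>bar\<in>H10 \<Omega>. \<exists>\<zeta>\<in>L2 \<Omega>. \<exists>wbar.
           ybar = solution_op \<Omega> a c0 (\<lambda>x. ubar x + f x) \<and>
           wbar = (\<lambda>x. w_reg p \<gamma> (ubar x)) \<and>
           solves_state \<Omega> a c0 (\<lambda>x. ubar x + f x) ybar \<and>
           solves_adjoint \<Omega> a c0 (\<lambda>x. ybar x - yd x) \<phi>bar \<and>
           (AE x in lebesgue_on \<Omega>.
              \<phi>bar x + \<alpha> * ubar x + \<beta> * (delta_reg p \<gamma> * \<zeta> x - wbar x) = 0) \<and>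
           (AE x in lebesgue_on \<Omega>.
              (ubar x > 0 \<longrightarrow> \<zeta> x = 1) \<and>
              (ubar x < 0 \<longrightarrow> \<zeta> x = -1) \<and>
              (ubar x = 0 \<longrightarrow> \<bar>\<zeta> x\<bar> \<le> 1))"
proof -
  have "open \<Omega>" and "bounded \<Omega>"
    using dom by (auto simp: bounded_lipschitz_domain_def)
  then have meas: "\<Omega> \<in> lmeasurable"
    by (simp add: bounded_set_imp_lmeasurable)
  have ex: "\<exists>\<psi>. solves_state \<Omega> a c0 g \<psi>" if "g \<in> L2 \<Omega>" for g
    using well_posed[OF that] by blast
  have S: "solves_state \<Omega> a c0 g (solution_op \<Omega> a c0 g)" if "g \<in> L2 \<Omega>" for g
    unfolding solution_op_def using ex[OF that] by (rule someI_ex)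
  obtain y where u: "ubar \<in> L2 \<Omega>" and y: "solves_state \<Omega> a c0 (\<lambda>x. ubar x + f x) y"
    and opt: "\<And>y' u'. feasible \<Omega> a c0 f y' u' \<Longrightarrow>
      objective \<Omega> p \<gamma> \<alpha> \<beta> yd y ubar \<le> objective \<Omega> p \<gamma> \<alpha> \<beta> yd y' u'"
    using optimal by (auto simp: optimal_control_def feasible_def)
  define ybar where "ybar = solution_op \<Omega> a c0 (\<lambda>x. ubar x + f x)"
  define \<phi>bar where "\<phi>bar = solution_op \<Omega> a c0 (\<lambda>x. ybar x - yd x)"
  have ybar: "solves_state \<Omega> a c0 (\<lambda>x. ubar x + f x) ybar"
    unfolding ybar_def by (intro S L2_add u f)
  then have \<phi>bar: "solves_state \<Omega> a c0 (\<lambda>x. ybar x - yd x) \<phi>bar"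
    unfolding \<phi>bar_def by (intro S L2_diff yd solves_state_L2)
  \<comment> \<open>Optimality is attained with some state \<open>y\<close>, while the claim
    concerns the representative chosen by \<open>solution_op\<close>. Both agree almost everywhere
    with \<open>y0\<close>, so the objective has the same value at \<open>ybar\<close>.\<close>
  obtain y0 where "\<And>y'. solves_state \<Omega> a c0 (\<lambda>x. ubar x + f x) y' \<Longrightarrow>
      AE x in lebesgue_on \<Omega>. y' x = y0 x"
    using well_posed[OF L2_add[OF u f]] by blast
  from this[OF y] this[OF ybar] have "AE x in lebesgue_on \<Omega>. y x - yd x = ybar x - yd x"
    by eventually_elim simp
  then have "(L2_norm \<Omega> (\<lambda>x. y x - yd x))\<^sup>2 = (L2_norm \<Omega> (\<lambda>x. ybar x - yd x))\<^sup>2"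
    unfolding L2_norm_power2
    using solves_state_L2[OF y] solves_state_L2[OF ybar] yd by (intro L2_inner_cong_AE L2_diff)
  then have opt_bar: "objective \<Omega> p \<gamma> \<alpha> \<beta> yd ybar ubar \<le> objective \<Omega> p \<gamma> \<alpha> \<beta> yd y' u'"
    if "feasible \<Omega> a c0 f y' u'" for y' u'
    using opt[OF that] by (simp add: objective_def)
  define W where "W = (\<lambda>x. w_reg p \<gamma> (ubar x))"
  define q where "q = (\<lambda>x. \<phi>bar x + \<alpha> * ubar x - \<beta> * W x)"
  define \<delta> where "\<delta> = delta_reg p \<gamma>"
  \<comment> \<open>Chosen so that the gradient equation holds at every point by algebra. All that
    the variational inequality has to supply is the sign condition.\<close>
  define \<zeta> where "\<zeta> = (\<lambda>x. (- 1 / (\<beta> * \<delta>)) * q x)"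
  have \<delta>: "0 < \<delta>"
    unfolding \<delta>_def by (rule regularization_parameters[OF p gamma])
  have q: "q \<in> L2 \<Omega>"
    unfolding q_def W_def
    by (intro L2_diff L2_add L2_scale u w_reg_L2[OF p gamma meas] solves_state_L2[OF \<phi>bar])
  have "AE x in lebesgue_on \<Omega>. if ubar x = 0 then \<bar>q x\<bar> \<le> \<beta> * \<delta> else q x = - (\<beta> * \<delta>) * sgn (ubar x)"
  proof (rule variational_inequality_imp_AE[OF meas q u])
    show "0 \<le> L2_inner \<Omega> q v + \<beta> * \<delta> * (LINT x|lebesgue_on \<Omega>. abs_dir_deriv (ubar x) (v x))"
      if "v \<in> L2 \<Omega>" for v
      unfolding q_def W_def \<delta>_def
      by (rule optimal_control_variational_inequality[OF meas p gamma beta a_sym ex f yd u that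
            ybar \<phi>bar opt_bar])
  qed (use beta \<delta> in simp)
  then have sign: "AE x in lebesgue_on \<Omega>. (ubar x > 0 \<longrightarrow> \<zeta> x = 1) \<and> (ubar x < 0 \<longrightarrow> \<zeta> x = -1) \<and>
      (ubar x = 0 \<longrightarrow> \<bar>\<zeta> x\<bar> \<le> 1)"
    by eventually_elim (use beta \<delta> in \<open>auto simp: \<zeta>_def abs_mult\<close>)
  have gradient: "\<phi>bar x + \<alpha> * ubar x + \<beta> * (delta_reg p \<gamma> * \<zeta> x - W x) = 0" for x
    using beta \<delta> by (simp add: \<zeta>_def q_def \<delta>_def[symmetric] field_simps)
  have adjoint: "solves_adjoint \<Omega> a c0 (\<lambda>x. ybar x - yd x) \<phi>bar"
    by (rule solves_adjoint_iff_solves_state[THEN iffD2, OF a_sym \<phi>bar])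
  show ?thesis
  proof (intro bexI exI conjI)
    show "ybar = solution_op \<Omega> a c0 (\<lambda>x. ubar x + f x)" "W = (\<lambda>x. w_reg p \<gamma> (ubar x))"
      by (fact ybar_def W_def)+
    show "AE x in lebesgue_on \<Omega>. \<phi>bar x + \<alpha> * ubar x + \<beta> * (delta_reg p \<gamma> * \<zeta> x - W x) = 0"
      using gradient by simp
    show "\<zeta> \<in> L2 \<Omega>"
      unfolding \<zeta>_def by (rule L2_scale[OF q])
    show "ybar \<in> H10 \<Omega>" "\<phi>bar \<in> H10 \<Omega>"
      using ybar \<phi>bar by (simp_all add: solves_state_def)
  qed (fact ybar adjoint sign)+
qed

end
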